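(* Let $n\ge 1$ and $0\le k\le n$ be integers, let $\boldsymbol p^0\in\mathbb R^n$, let $\boldsymbol\delta\in\mathbb R^n$ with $\delta_i>0$ for all $i$, and let $\boldsymbol q\in\mathbb R^n$. For each $i$ let $\Delta_i = (p_i^0-q_i)^2-d(q_i,\mathcal P^i_{\delta_i})$, and let $((1),(2),\dots,(n))$ be an ordering of the indices $\{1,\dots,n\}$ such that $\Delta_{(1)}\ge\Delta_{(2)}\ge\cdots\ge\Delta_{(n)}$. Let $\widetilde{\boldsymbol p}\in\mathbb R^n$ satisfy $$\widetilde p_i\in\Pi_{\mathcal P^i_{\delta_i}}(q_i)\ \text{ if } i\in\{(1),\dots,(k)\},\qquad \widetilde p_i=p_i^0\ \text{ otherwise}.$$ Then $\widetilde{\boldsymbol p}$ is an optimal solution of the projection problem $$\min_{\boldsymbol p\in\mathbb R^n}\ \|\boldsymbol p-\boldsymbol q\|_2^2\quad\text{s.t.}\quad \|\boldsymbol p-\boldsymbol p^0\|_0\le k,\quad \boldsymbol p\in\mathcal P_{\boldsymbol\delta}.$$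
   Context: For $\boldsymbol v\in\mathbb R^n$, $\|\boldsymbol v\|_0$ denotes the number of nonzero entries of $\boldsymbol v$. For each $i$, $\mathcal P^i_{\delta_i}=\{p_i^0\}\cup[p_i^0+\delta_i,\infty)\cup(-\infty,p_i^0-\delta_i]\subseteq\mathbb R$, and $\mathcal P_{\boldsymbol\delta}=\mathcal P^1_{\delta_1}\times\cdots\times\mathcal P^n_{\delta_n}\subseteq\mathbb R^n$. For $q_i\in\mathbb R$, $\Pi_{\mathcal P^i_{\delta_i}}(q_i)=\arg\min_{p_i\in\mathcal P^i_{\delta_i}}(p_i-q_i)^2$ is the set of all minimizers (possibly with more than one element), and $d(q_i,\mathcal P^i_{\delta_i})=\min_{p_i\in\mathcal P^i_{\delta_i}}(p_i-q_i)^2$ is the squared distance. *)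

theory Defs
  imports "HOL-Analysis.Analysis"
begin

definition l0_norm :: "real ^ 'n \<Rightarrow> nat" where
  "l0_norm v = card {i. v $ i \<noteq> 0}"

definition price_set :: "real \<Rightarrow> real \<Rightarrow> real set" where
  "price_set a d = {a} \<union> {a + d..} \<union> {..a - d}"

definition price_box :: "real ^ 'n \<Rightarrow> real ^ 'n \<Rightarrow> (real ^ 'n) set" where
  "price_box p0 \<delta> = {p. \<forall>i. p $ i \<in> price_set (p0 $ i) (\<delta> $ i)}"

definition proj_set :: "real set \<Rightarrow> real \<Rightarrow> real set" where
  "proj_set S x = {y. is_arg_min (\<lambda>y. (y - x)\<^sup>2) (\<lambda>y. y \<in> S) y}"

(* A minimum, not merely an infimum: meaningful for nonempty closed S, see sqdist_attained. *)
definition sqdist :: "real \<Rightarrow> real set \<Rightarrow> real" where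
  "sqdist x S = (LEAST r. \<exists>y\<in>S. r = (y - x)\<^sup>2)"

definition gap :: "real ^ 'n \<Rightarrow> real ^ 'n \<Rightarrow> real ^ 'n \<Rightarrow> 'n \<Rightarrow> real" where
  "gap p0 \<delta> q i = (p0 $ i - q $ i)\<^sup>2 - sqdist (q $ i) (price_set (p0 $ i) (\<delta> $ i))"

lemma closed_price_set: "closed (price_set a d)"
  unfolding price_set_def by (intro closed_Un) auto

lemma sqdist_attained:
  assumes "closed S" "S \<noteq> {}"
  shows "\<exists>y\<in>S. sqdist x S = (y - x)\<^sup>2 \<and> (\<forall>z\<in>S. (y - x)\<^sup>2 \<le> (z - x)\<^sup>2)"
proof -
  obtain y where y: "y \<in> S" "\<And>z. z \<in> S \<Longrightarrow> dist x y \<le> dist x z"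
    using distance_attains_inf[OF assms] by metis
  have le: "(y - x)\<^sup>2 \<le> (z - x)\<^sup>2" if "z \<in> S" for z
    using y(2)[OF that] by (simp add: dist_real_def abs_minus_commute flip: abs_le_square_iff)
  have "sqdist x S = (y - x)\<^sup>2"
    unfolding sqdist_def using y(1) le by (intro Least_equality) auto
  with y(1) le show ?thesis by blast
qed

end

theory Submission
  imports Defs
begin

text \<open>Moving coordinate \<open>i\<close> away from \<open>p0 $ i\<close> lowers the squared distance to \<open>q\<close> by at most
  \<open>gap p0 \<delta> q i \<ge> 0\<close>, with equality at a projection. Hence a feasible \<open>p\<close> with support
  \<open>A\<close> of \<open>p - p0\<close> costs at least the cost of \<open>p0\<close> minus the total gap over \<open>A\<close>, and among the sets of
  at most \<open>k\<close> indices the total gap is largest for the \<open>k\<close> indices of largest gap.\<close>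

text \<open>Terms over \<open>A \<inter> B\<close> are common to both sums. An injection of
  \<open>A - B\<close> into \<open>B - A\<close> never decreases \<open>f\<close>, and the indices
  of \<open>B - A\<close> that it misses contribute nonnegative terms.\<close>

lemma sum_le_sum_of_dominating_set:
  fixes f :: "'a \<Rightarrow> 'b :: ordered_comm_monoid_add"
  assumes fin: "finite A" "finite B" and card: "card A \<le> card B"
    and nonneg: "\<And>b. b \<in> B \<Longrightarrow> 0 \<le> f b"
    and dom: "\<And>a b. a \<in> A - B \<Longrightarrow> b \<in> B - A \<Longrightarrow> f a \<le> f b"
  shows "sum f A \<le> sum f B"
proof -
  \<comment> \<open>Both differences lose the same \<open>card (A \<inter> B)\<close>
    elements.\<close>
  have "card (A - B) \<le> card (B - A)"
    using card fin by (simp add: card_Diff_subset_Int Int_commute diff_le_mono)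
  then obtain g where g: "g ` (A - B) \<subseteq> B - A" "inj_on g (A - B)"
    using card_le_inj[of "A - B" "B - A"] fin by blast
  have "sum f (A - B) \<le> (\<Sum>a\<in>A - B. f (g a))"
    using g(1) dom by (intro sum_mono) auto
  also have "\<dots> = sum f (g ` (A - B))"
    using g(2) by (simp add: sum.reindex)
  also have "\<dots> \<le> sum f (B - A)"
    using g(1) fin nonneg by (intro sum_mono2) auto
  finally have "sum f (A \<inter> B) + sum f (A - B) \<le> sum f (B \<inter> A) + sum f (B - A)"
    by (simp add: Int_commute add_left_mono)
  then show ?thesis
    using fin by (simp flip: sum.Int_Diff)
qed

lemma base_in_price_set: "a \<in> price_set a d"
  by (simp add: price_set_def)

lemma sqdist_price_set_le:
  assumes "y \<in> price_set a d"
  shows "sqdist x (price_set a d) \<le> (y - x)\<^sup>2"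
  using sqdist_attained[OF closed_price_set, of a d x] assms by (metis empty_iff)

text \<open>All minimizers attain the same value, so ties in the projection do not affect the
  cost.\<close>

lemma sqdist_proj_set_price_set:
  assumes "y \<in> proj_set (price_set a d) x"
  shows "sqdist x (price_set a d) = (y - x)\<^sup>2"
proof (rule antisym)
  show "sqdist x (price_set a d) \<le> (y - x)\<^sup>2"
    using assms by (intro sqdist_price_set_le) (simp add: proj_set_def is_arg_min_def)
  obtain z where "z \<in> price_set a d" "sqdist x (price_set a d) = (z - x)\<^sup>2"
    using sqdist_attained[OF closed_price_set, of a d x] base_in_price_set by blast
  then show "(y - x)\<^sup>2 \<le> sqdist x (price_set a d)"
    using assms by (simp add: proj_set_def is_arg_min_linorder)
qed

text \<open>The base value is itself an admissible competitor for the minimum.\<close>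

lemma gap_nonneg: "0 \<le> gap p0 \<delta> q i"
  by (simp add: gap_def sqdist_price_set_le base_in_price_set)

lemma norm_diff_sq_eq_sum:
  fixes p q :: "real ^ 'n"
  shows "(norm (p - q))\<^sup>2 = (\<Sum>i\<in>UNIV. (p $ i - q $ i)\<^sup>2)"
  by (simp add: norm_vec_def L2_set_def sum_nonneg)

text \<open>Read from right to left, this reduces claims about total cost to one claim per
  coordinate.\<close>

lemma sum_minus_sum_subset:
  fixes f g :: "'n :: finite \<Rightarrow> real"
  shows "(\<Sum>i\<in>UNIV. f i - (if i \<in> A then g i else 0)) = sum f UNIV - sum g A"
  by (simp add: sum_subtractf flip: sum.inter_restrict)

theorem proposition7:
  fixes p0 \<delta> q pt :: "real ^ 'n" and k :: nat and \<sigma> :: "nat \<Rightarrow> 'n"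
  assumes "k \<le> CARD('n)"
    and "\<And>i. \<delta> $ i > 0"
    and "bij_betw \<sigma> {1..CARD('n)} UNIV"
    and "\<And>j l. 1 \<le> j \<Longrightarrow> j \<le> l \<Longrightarrow> l \<le> CARD('n) \<Longrightarrow> gap p0 \<delta> q (\<sigma> j) \<ge> gap p0 \<delta> q (\<sigma> l)"
    and "\<And>i. i \<in> \<sigma> ` {1..k} \<Longrightarrow> pt $ i \<in> proj_set (price_set (p0 $ i) (\<delta> $ i)) (q $ i)"
    and "\<And>i. i \<notin> \<sigma> ` {1..k} \<Longrightarrow> pt $ i = p0 $ i"
  shows "is_arg_min (\<lambda>p. (norm (p - q))\<^sup>2)
           (\<lambda>p. l0_norm (p - p0) \<le> k \<and> p \<in> price_box p0 \<delta>) pt"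
proof -
  define T where "T = \<sigma> ` {1..k}"
  define G where "G = gap p0 \<delta> q"
  define c where "c i = (p0 $ i - q $ i)\<^sup>2" for i
  have "inj_on \<sigma> {1..k}"
    using assms(1,3) by (auto simp: bij_betw_def intro: inj_on_subset)
  then have card_T: "card T = k"
    by (simp add: T_def card_image)
  have G_le: "G i \<le> G t" if "i \<notin> T" "t \<in> T" for i t
  proof -
    obtain l where l: "i = \<sigma> l" "1 \<le> l" "l \<le> CARD('n)"
      using assms(3) by (metis UNIV_I atLeastAtMost_iff bij_betw_def imageE)
    obtain j where j: "t = \<sigma> j" "1 \<le> j" "j \<le> k"
      using \<open>t \<in> T\<close> by (auto simp: T_def)
    \<comment> \<open>Otherwise \<open>l < j \<le> k\<close>, which would put \<open>i\<close> into
      \<open>T\<close>.\<close>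
    have "j \<le> l"
      using \<open>i \<notin> T\<close> l j(3) by (force simp: T_def)
    then show ?thesis
      using assms(4)[of j l] l j by (simp add: G_def)
  qed
  have cost_pt: "(norm (pt - q))\<^sup>2 = sum c UNIV - sum G T"
    unfolding norm_diff_sq_eq_sum sum_minus_sum_subset[symmetric]
  proof (intro sum.cong refl)
    fix i
    show "(pt $ i - q $ i)\<^sup>2 = c i - (if i \<in> T then G i else 0)"
      using assms(5,6)[of i] sqdist_proj_set_price_set[of "pt $ i" "p0 $ i" "\<delta> $ i" "q $ i"]
      by (simp add: T_def G_def c_def gap_def)
  qed
  have cost_le: "(norm (pt - q))\<^sup>2 \<le> (norm (p - q))\<^sup>2"
    if "l0_norm (p - p0) \<le> k" "p \<in> price_box p0 \<delta>" for p
  proof -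
    define A where "A = {i. (p - p0) $ i \<noteq> 0}"
    have "sum G A \<le> sum G T"
      using that(1) G_le
      by (intro sum_le_sum_of_dominating_set) (auto simp: A_def card_T l0_norm_def G_def gap_nonneg)
    then have "(norm (pt - q))\<^sup>2 \<le> sum c UNIV - sum G A"
      by (simp add: cost_pt)
    \<comment> \<open>On \<open>A\<close>, \<open>c i - G i\<close> is the squared distance from
      \<open>q $ i\<close> to the price set, which bounds the cost of \<open>p $ i\<close> from
      below; off \<open>A\<close>, \<open>p $ i = p0 $ i\<close> and the costs agree.\<close>
    also have "\<dots> \<le> (norm (p - q))\<^sup>2"
      unfolding norm_diff_sq_eq_sum sum_minus_sum_subset[symmetric]
      using that(2)
      by (intro sum_mono) (auto simp: A_def G_def c_def gap_def price_box_def sqdist_price_set_le)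
    finally show ?thesis .
  qed
  \<comment> \<open>The inclusion can be strict, since a projection may be \<open>p0 $ i\<close>
    itself.\<close>
  have "{i. (pt - p0) $ i \<noteq> 0} \<subseteq> T"
    using assms(6) by (auto simp: T_def)
  then have "l0_norm (pt - p0) \<le> k"
    using card_mono[of T] card_T by (auto simp: l0_norm_def)
  moreover have "pt $ i \<in> price_set (p0 $ i) (\<delta> $ i)" for i
    using assms(5,6)[of i] by (cases "i \<in> T") (auto simp: T_def proj_set_def is_arg_min_def base_in_price_set)
  ultimately show ?thesis
    using cost_le by (simp add: is_arg_min_linorder price_box_def)
qed

end
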